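(* Consider the constrained optimization model $$u^*:=\min_{\mathbf{x}}\Big\{f(\mathbf{x})\ :\ \mathbf{x}\in\bigcap_{i=1}^N X_i\Big\},$$ where each $X_i\subseteq\mathbb{Z}^{p_1}\times\mathbb{R}^{n_1-p_1}$ is a mixed-integer set and $f:\mathbb{R}^{n_1}\to\mathbb{R}$ is a deterministic objective function such that $$0\ \le\ \inf_{\mathbf{x}\in\bigcup_{i\in[N]}X_i}f(\mathbf{x})\ \le\ \sup_{\mathbf{x}\in\bigcup_{i\in[N]}X_i}f(\mathbf{x})\ <\ \infty.$$ Then $$u^*\ =\ \max\Big\{\frac1N\sum_{i=1}^N\min_{\mathbf{x}^i\in X_i}\{f(\mathbf{x}^i)+g_i(\mathbf{x}^i)\}\ :\ g_i:\bigcup_{j=1}^N X_j\to\mathbb{R}\ \ \forall i\in[N],\ \ \sum_{i=1}^N g_i(\mathbf{x})=0\ \ \forall\mathbf{x}\in\bigcup_{j=1}^N X_j\Big\}.$$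
   Context: $[N]:=\{1,\dots,N\}$. The outer maximum is over all $N$-tuples of real-valued functions $(g_1,\dots,g_N)$ on $\bigcup_{j=1}^N X_j$ that sum to zero pointwise. *)

theory Defs
  imports "Jordan_Normal_Form.Matrix" "HOL-Library.Extended_Real"
begin

text \<open>
  Points of \<open>n\<close>-dimensional real space are the elements of \<^term>\<open>carrier_vec n\<close>; the first
  \<open>p\<close> coordinates (counted from 0) are the integral ones.
\<close>

definition mixed_integer_space :: "nat \<Rightarrow> nat \<Rightarrow> real vec set" where
  "mixed_integer_space p n = {x \<in> carrier_vec n. \<forall>j<p. x $ j \<in> \<int>}"

text \<open>
  Optimal values are taken in the extended reals, so that an infeasible minimization has
  value \<open>\<infinity>\<close> and an unbounded one has value \<open>-\<infinity>\<close>. Whether the optima are attained is a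
  separate matter.
\<close>

definition primal_value :: "nat \<Rightarrow> (nat \<Rightarrow> 'a set) \<Rightarrow> ('a \<Rightarrow> real) \<Rightarrow> ereal" where
  "primal_value N X f = (INF x\<in>(\<Inter>i\<in>{1..N}. X i). ereal (f x))"

text \<open>
  Tuples of real functions on the union of the \<open>X j\<close>. They are represented by total functions;
  their values outside the union are unconstrained and never used.
\<close>

definition zero_sum_tuples :: "nat \<Rightarrow> (nat \<Rightarrow> 'a set) \<Rightarrow> (nat \<Rightarrow> 'a \<Rightarrow> real) set" where
  "zero_sum_tuples N X = {g. \<forall>x\<in>(\<Union>j\<in>{1..N}. X j). (\<Sum>i=1..N. g i x) = 0}"

text \<open>
  For \<^typ>\<open>ereal\<close>, \<open>\<infinity> + -\<infinity> = \<infinity>\<close>. Such a sum can occur only if some \<open>X i\<close> is empty.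
\<close>

definition dual_value ::
  "nat \<Rightarrow> (nat \<Rightarrow> 'a set) \<Rightarrow> ('a \<Rightarrow> real) \<Rightarrow> (nat \<Rightarrow> 'a \<Rightarrow> real) \<Rightarrow> ereal" where
  "dual_value N X f g =
     ereal (1 / real N) * (\<Sum>i=1..N. INF x\<in>X i. ereal (f x + g i x))"

end

theory Submission
  imports Defs
begin

text \<open>
  A common point of all \<open>X i\<close> bounds every dual value, because the penalties cancel there. For
  the converse take a real \<open>c\<close> below the optimal value. At a point outside the intersection,
  which lies in \<open>k < N\<close> of the sets, charge \<open>c\<close> to each of these \<open>k\<close> sets and
  split the compensating amount \<open>- c k\<close> evenly among the other \<open>N - k\<close> sets, whose
  subproblems never see the point. As \<open>f \<ge> 0\<close>, every subproblem then has value at least \<open>c\<close>.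
\<close>

text \<open>The bound is compared with one common point at a time, so an empty intersection, where
  the optimal value is \<infinity>, needs no separate case.\<close>

lemma dual_value_le_primal_value:
  assumes "N \<ge> 1" and g: "g \<in> zero_sum_tuples N X"
  shows "dual_value N X f g \<le> primal_value N X f"
  unfolding primal_value_def
proof (rule INF_greatest)
  fix x assume x: "x \<in> (\<Inter>i\<in>{1..N}. X i)"
  have "(\<Sum>i=1..N. INF y\<in>X i. ereal (f y + g i y)) \<le> (\<Sum>i=1..N. ereal (f x + g i x))"
    using x by (intro sum_mono INF_lower) auto
  also have "\<dots> = ereal (real N * f x + (\<Sum>i=1..N. g i x))"
    by (simp add: sum.distrib)
  \<comment> \<open>\<open>N \<ge> 1\<close> puts the common point in the union, the only place
    where the tuple is known to sum to zero.\<close>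
  also have "(\<Sum>i=1..N. g i x) = 0"
    using g x assms(1) by (force simp: zero_sum_tuples_def)
  finally have "dual_value N X f g \<le> ereal (1 / real N) * ereal (real N * f x + 0)"
    unfolding dual_value_def by (intro ereal_mult_left_mono) auto
  then show "dual_value N X f g \<le> ereal (f x)"
    using assms(1) by simp
qed

lemma dual_value_ge:
  assumes "N \<ge> 1" and "\<And>i x. i \<in> {1..N} \<Longrightarrow> x \<in> X i \<Longrightarrow> c \<le> f x + g i x"
  shows "ereal c \<le> dual_value N X f g"
proof -
  have "ereal (real N * c) = (\<Sum>i=1..N. ereal c)"
    by simp
  also have "\<dots> \<le> (\<Sum>i=1..N. INF x\<in>X i. ereal (f x + g i x))"
    using assms(2) by (intro sum_mono INF_greatest) auto
  finally have "ereal (1 / real N) * ereal (real N * c) \<le> dual_value N X f g"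
    unfolding dual_value_def by (intro ereal_mult_left_mono) auto
  then show ?thesis
    using assms(1) by simp
qed

text \<open>Equality in the bound on \<open>c\<close> is allowed, so a finite optimal value can
  itself be taken as \<open>c\<close>; this yields an optimal tuple and not just a supremum.\<close>

lemma zero_sum_penalties_exist:
  assumes f: "\<And>x. x \<in> (\<Union>i\<in>{1..N}. X i) \<Longrightarrow> 0 \<le> f x"
    and c: "ereal c \<le> primal_value N X f"
  obtains g where "g \<in> zero_sum_tuples N X"
    and "\<And>i x. i \<in> {1..N} \<Longrightarrow> x \<in> X i \<Longrightarrow> c \<le> f x + g i x"
proof -
  define S where "S x = {i\<in>{1..N}. x \<in> X i}" for x
  define g where "g i x = (if S x = {1..N} then 0 else if i \<in> S x then c
    else - c * real (card (S x)) / real (card ({1..N} - S x)))" for i x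
  have "(\<Sum>i=1..N. g i x) = 0" for x
  proof (cases "S x = {1..N}")
    case False
    have sub: "S x \<subseteq> {1..N}"
      by (auto simp: S_def)
    with False have "{1..N} - S x \<noteq> {}"
      by blast
    then have "card ({1..N} - S x) \<noteq> 0"
      by simp
    \<comment> \<open>The complement contributes \<open>- c * card (S x)\<close> once its nonzero
      cardinality cancels, and \<open>S x\<close> contributes \<open>c * card (S x)\<close>.\<close>
    moreover have "(\<Sum>i=1..N. g i x) = (\<Sum>i\<in>{1..N} - S x. g i x) + (\<Sum>i\<in>S x. g i x)"
      using sub by (intro sum.subset_diff) auto
    ultimately show ?thesis
      using False by (simp add: g_def del: card_Diff_subset)
  qed (simp add: g_def)
  moreover have "c \<le> f x + g i x" if "i \<in> {1..N}" "x \<in> X i" for i x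
  proof (cases "S x = {1..N}")
    case True
    then have "x \<in> (\<Inter>i\<in>{1..N}. X i)"
      by (auto simp: S_def)
    then have "primal_value N X f \<le> ereal (f x)"
      unfolding primal_value_def by (rule INF_lower)
    with c True show ?thesis
      by (auto simp: g_def dest: order_trans)
  next
    case False
    moreover have "0 \<le> f x"
      using that by (intro f) blast
    ultimately show ?thesis
      using that by (auto simp: g_def S_def)
  qed
  ultimately show ?thesis
    by (intro that[of g]) (auto simp: zero_sum_tuples_def)
qed

text \<open>Attainment is stated apart from equality: if the intersection is empty but no
  \<open>X i\<close> is, every dual value is below \<infinity> and the supremum \<infinity> is not
  reached. For \<open>N = 1\<close> the inner minimum is the primal one, whence the premise of the
  last conjunct.\<close>

theorem theorem5:
  fixes N p1 n1 :: nat
    and X :: "nat \<Rightarrow> real vec set"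
    and f :: "real vec \<Rightarrow> real"
  assumes "N \<ge> 1" and "p1 \<le> n1"
    and "\<And>i. i \<in> {1..N} \<Longrightarrow> X i \<subseteq> mixed_integer_space p1 n1"
    and "0 \<le> (INF x\<in>(\<Union>i\<in>{1..N}. X i). ereal (f x))"
    and "(INF x\<in>(\<Union>i\<in>{1..N}. X i). ereal (f x)) \<le> (SUP x\<in>(\<Union>i\<in>{1..N}. X i). ereal (f x))"
    and "(SUP x\<in>(\<Union>i\<in>{1..N}. X i). ereal (f x)) < \<infinity>"
  shows "primal_value N X f = (SUP g\<in>zero_sum_tuples N X. dual_value N X f g)
    \<and> ((\<Inter>i\<in>{1..N}. X i) \<noteq> {} \<longrightarrow>
         (\<exists>g\<in>zero_sum_tuples N X. dual_value N X f g = primal_value N X f))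
    \<and> ((\<exists>x. is_arg_min f (\<lambda>x. x \<in> (\<Inter>i\<in>{1..N}. X i)) x) \<longrightarrow>
         (\<exists>g\<in>zero_sum_tuples N X. dual_value N X f g = primal_value N X f \<and>
            (\<forall>i\<in>{1..N}. \<exists>x. is_arg_min (\<lambda>x. f x + g i x) (\<lambda>x. x \<in> X i) x)))"
proof (intro conjI impI)
  have nonneg: "0 \<le> f x" if "x \<in> (\<Union>i\<in>{1..N}. X i)" for x
  proof -
    have "0 \<le> ereal (f x)"
      using assms(4) INF_lower[OF that] by (rule order_trans)
    then show ?thesis by simp
  qed
  have weak: "dual_value N X f g \<le> primal_value N X f" if "g \<in> zero_sum_tuples N X" for g
    using assms(1) that by (rule dual_value_le_primal_value)

  show "primal_value N X f = (SUP g\<in>zero_sum_tuples N X. dual_value N X f g)"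
  proof (rule antisym)
    show "(SUP g\<in>zero_sum_tuples N X. dual_value N X f g) \<le> primal_value N X f"
      using weak by (rule SUP_least)
    show "primal_value N X f \<le> (SUP g\<in>zero_sum_tuples N X. dual_value N X f g)"
    \<comment> \<open>The optimal value may be \<infinity>, where no single real \<open>c\<close>
      suffices, so it is approached from below.\<close>
    proof (rule dense_le)
      fix w assume w: "w < primal_value N X f"
      show "w \<le> (SUP g\<in>zero_sum_tuples N X. dual_value N X f g)"
      proof (cases w)
        case (real c)
        with w have le: "ereal c \<le> primal_value N X f"
          by simp
        obtain g where g: "g \<in> zero_sum_tuples N X"
          and "\<And>i x. i \<in> {1..N} \<Longrightarrow> x \<in> X i \<Longrightarrow> c \<le> f x + g i x"
          using zero_sum_penalties_exist[OF nonneg le] by blast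
        then show ?thesis
          unfolding real using assms(1) by (intro SUP_upper2[OF g] dual_value_ge)
      qed (use w in auto)
    qed
  qed

  show "\<exists>g\<in>zero_sum_tuples N X. dual_value N X f g = primal_value N X f"
    if nonempty: "(\<Inter>i\<in>{1..N}. X i) \<noteq> {}"
  proof -
    obtain y where y: "y \<in> (\<Inter>i\<in>{1..N}. X i)"
      using nonempty by blast
    \<comment> \<open>Bounded above by a feasible value and below by 0, the optimal value is a real
      \<open>c\<close>.\<close>
    have "primal_value N X f \<le> ereal (f y)"
      unfolding primal_value_def using y by (rule INF_lower)
    moreover have "0 \<le> primal_value N X f"
      unfolding primal_value_def using nonneg assms(1) by (intro INF_greatest) force
    ultimately obtain c where c: "primal_value N X f = ereal c"
      by (cases "primal_value N X f") auto
    then have le: "ereal c \<le> primal_value N X f"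
      by simp
    obtain g where g: "g \<in> zero_sum_tuples N X"
      and "\<And>i x. i \<in> {1..N} \<Longrightarrow> x \<in> X i \<Longrightarrow> c \<le> f x + g i x"
      using zero_sum_penalties_exist[OF nonneg le] by blast
    then have "ereal c \<le> dual_value N X f g"
      using assms(1) by (intro dual_value_ge)
    with weak[OF g] g c show ?thesis
      by (intro bexI[of _ g]) auto
  qed

  show "\<exists>g\<in>zero_sum_tuples N X. dual_value N X f g = primal_value N X f \<and>
      (\<forall>i\<in>{1..N}. \<exists>x. is_arg_min (\<lambda>x. f x + g i x) (\<lambda>x. x \<in> X i) x)"
    if attained: "\<exists>x. is_arg_min f (\<lambda>x. x \<in> (\<Inter>i\<in>{1..N}. X i)) x"
  proof -
    obtain y where y: "y \<in> (\<Inter>i\<in>{1..N}. X i)"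
      and min: "\<And>x. x \<in> (\<Inter>i\<in>{1..N}. X i) \<Longrightarrow> f y \<le> f x"
      using attained unfolding is_arg_min_linorder by blast
    have p: "primal_value N X f = ereal (f y)"
      unfolding primal_value_def using y min
      by (intro antisym INF_lower INF_greatest) auto
    then have le: "ereal (f y) \<le> primal_value N X f"
      by simp
    obtain g where g: "g \<in> zero_sum_tuples N X"
      and low: "\<And>i x. i \<in> {1..N} \<Longrightarrow> x \<in> X i \<Longrightarrow> f y \<le> f x + g i x"
      using zero_sum_penalties_exist[OF nonneg le] by blast
    have "ereal (f y) \<le> dual_value N X f g"
      using assms(1) low by (rule dual_value_ge)
    with weak[OF g] p have eq: "dual_value N X f g = primal_value N X f"
      by simp
    \<comment> \<open>The lower bound \<open>f y\<close>, read at \<open>y\<close> itself, makes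
      each penalty there nonnegative. Summing to zero, they all vanish, so \<open>y\<close>
      minimizes every subproblem.\<close>
    have pos: "0 \<le> g i y" if "i \<in> {1..N}" for i
      using low[of i y] that y by auto
    have "(\<Sum>i=1..N. g i y) = 0"
      using g y assms(1) by (force simp: zero_sum_tuples_def)
    then have zero: "g i y = 0" if "i \<in> {1..N}" for i
      using that pos by (subst (asm) sum_nonneg_eq_0_iff) auto
    have "is_arg_min (\<lambda>x. f x + g i x) (\<lambda>x. x \<in> X i) y" if "i \<in> {1..N}" for i
      using that y low zero unfolding is_arg_min_linorder by auto
    with g eq show ?thesis
      by blast
  qed
qed

end
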